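(* Let $G$ be a finite group, and let $h\in\mathrm{Sym}(G)$. Then $$\pi_{\mathrm{FHW}}(L_h)=\begin{cases}(0,0,0), & \text{if }|G|\equiv0\pmod 4,\\ (0,\pi(h),\pi(h)), & \text{if }|G|\equiv1\pmod 4,\\ (1,1,1), & \text{if }|G|\equiv2\pmod 4,\\ (0,\pi(h),\pi(h)+1), & \text{if }|G|\equiv3\pmod 4.\end{cases}$$
   Context: For a finite set $X$, $\pi:\mathrm{Sym}(X)\to\mathbb{F}_2$ denotes parity: $\pi(f)=0$ if $f$ is even and $\pi(f)=1$ if $f$ is odd. A Latin square over $X=\{x_1,\ldots,x_n\}$ ($|X|=n$, with this fixed ordering) is a matrix $L=(\ell_{i,j})_{1\leq i,j\leq n}$ with entries in $X$ such that each element of $X$ occurs exactly once in each row and in each column. Its $i$-th row permutation is the permutation $P_i\in\mathrm{Sym}(X)$ with $P_i(x_j)=\ell_{i,j}$ for all $j$; its $j$-th column permutation is $Q_j\in\mathrm{Sym}(X)$ with $Q_j(x_i)=\ell_{i,j}$ for all $i$; for $x\in X$, its $x$-symbol permutation is $R_x\in\mathrm{Sym}(X)$ such that $R_x(x_i)=x_j$ if and only if $\ell_{i,j}=x$. The row parity $\pi_r(L)$, column parity $\pi_c(L)$ and symbol parity $\pi_s(L)$ are the sums in $\mathbb{F}_2$ of the parities of all row permutations, of all column permutations, and of all symbol permutations (over all $x\in X$), respectively. The FHW parity type of $L$ is $\pi_{\mathrm{FHW}}(L)=(\pi_r(L),\pi_c(L),\pi_s(L))\in\mathbb{F}_2^3$.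 For a finite group $G=\{g_1,\ldots,g_n\}$ of order $n$ and $h\in\mathrm{Sym}(G)$, $L_h=L_h(G)$ is the Latin square $(h(g_i)g_j)_{1\leq i,j\leq n}$ over $G$. *)

theory Defs
  imports
    "HOL-Algebra.Coset"
    "HOL-Combinatorics.Permutations"
    "HOL-Library.Z2"
begin

text \<open>
  The symmetric group on a finite set \<open>X\<close> is the set of all \<open>f\<close> with \<open>f permutes X\<close>; the field with
  two elements is \<^typ>\<open>bit\<close>. An ordering \<open>x\<^sub>1, \<dots>, x\<^sub>n\<close> of \<open>X\<close> is a map \<open>x\<close> with
  \<open>bij_betw x {1..card X} X\<close>. A matrix over \<open>X\<close> is a map \<open>L :: nat \<Rightarrow> nat \<Rightarrow> 'a\<close>, of which only the
  entries \<open>L i j\<close> with \<open>i, j \<in> {1..card X}\<close> are meaningful.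
\<close>

definition perm_parity :: "('a \<Rightarrow> 'a) \<Rightarrow> bit" where
  "perm_parity f = (if evenperm f then 0 else 1)"

definition latin_square :: "'a set \<Rightarrow> (nat \<Rightarrow> nat \<Rightarrow> 'a) \<Rightarrow> bool" where
  "latin_square X L \<longleftrightarrow>
     finite X \<and>
     (\<forall>i\<in>{1..card X}. \<forall>j\<in>{1..card X}. L i j \<in> X) \<and>
     (\<forall>i\<in>{1..card X}. \<forall>s\<in>X. \<exists>!j. j \<in> {1..card X} \<and> L i j = s) \<and>
     (\<forall>j\<in>{1..card X}. \<forall>s\<in>X. \<exists>!i. i \<in> {1..card X} \<and> L i j = s)"

definition row_perm :: "'a set \<Rightarrow> (nat \<Rightarrow> 'a) \<Rightarrow> (nat \<Rightarrow> nat \<Rightarrow> 'a) \<Rightarrow> nat \<Rightarrow> 'a \<Rightarrow> 'a" where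
  "row_perm X x L i = (THE P. P permutes X \<and> (\<forall>j\<in>{1..card X}. P (x j) = L i j))"

definition col_perm :: "'a set \<Rightarrow> (nat \<Rightarrow> 'a) \<Rightarrow> (nat \<Rightarrow> nat \<Rightarrow> 'a) \<Rightarrow> nat \<Rightarrow> 'a \<Rightarrow> 'a" where
  "col_perm X x L j = (THE Q. Q permutes X \<and> (\<forall>i\<in>{1..card X}. Q (x i) = L i j))"

definition symbol_perm :: "'a set \<Rightarrow> (nat \<Rightarrow> 'a) \<Rightarrow> (nat \<Rightarrow> nat \<Rightarrow> 'a) \<Rightarrow> 'a \<Rightarrow> 'a \<Rightarrow> 'a" where
  "symbol_perm X x L s =
     (THE R. R permutes X \<and> (\<forall>i\<in>{1..card X}. \<forall>j\<in>{1..card X}. R (x i) = x j \<longleftrightarrow> L i j = s))"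

definition row_parity :: "'a set \<Rightarrow> (nat \<Rightarrow> 'a) \<Rightarrow> (nat \<Rightarrow> nat \<Rightarrow> 'a) \<Rightarrow> bit" where
  "row_parity X x L = (\<Sum>i\<in>{1..card X}. perm_parity (row_perm X x L i))"

definition col_parity :: "'a set \<Rightarrow> (nat \<Rightarrow> 'a) \<Rightarrow> (nat \<Rightarrow> nat \<Rightarrow> 'a) \<Rightarrow> bit" where
  "col_parity X x L = (\<Sum>j\<in>{1..card X}. perm_parity (col_perm X x L j))"

definition symbol_parity :: "'a set \<Rightarrow> (nat \<Rightarrow> 'a) \<Rightarrow> (nat \<Rightarrow> nat \<Rightarrow> 'a) \<Rightarrow> bit" where
  "symbol_parity X x L = (\<Sum>s\<in>X. perm_parity (symbol_perm X x L s))"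

definition FHW_parity :: "'a set \<Rightarrow> (nat \<Rightarrow> 'a) \<Rightarrow> (nat \<Rightarrow> nat \<Rightarrow> 'a) \<Rightarrow> bit \<times> bit \<times> bit" where
  "FHW_parity X x L = (row_parity X x L, col_parity X x L, symbol_parity X x L)"

definition group_square ::
    "('a, 'b) monoid_scheme \<Rightarrow> (nat \<Rightarrow> 'a) \<Rightarrow> ('a \<Rightarrow> 'a) \<Rightarrow> nat \<Rightarrow> nat \<Rightarrow> 'a" where
  "group_square G g h = (\<lambda>i j. h (g i) \<otimes>\<^bsub>G\<^esub> g j)"

text \<open>
  The definite descriptions above are well defined for Latin squares, and the squares
  \<^const>\<open>group_square\<close> are Latin squares.
\<close>

lemma ex1_perm_of_bij:
  assumes x: "bij_betw x A X" and f: "bij_betw f A X"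
  shows "\<exists>!P. P permutes X \<and> (\<forall>j\<in>A. P (x j) = f j)"
proof (rule ex1I)
  define P where "P y = (if y \<in> X then f (inv_into A x y) else y)" for y
  have "bij_betw (f \<circ> inv_into A x) X X"
    using bij_betw_trans[OF bij_betw_inv_into[OF x] f] .
  then have "bij_betw P X X"
    by (rule bij_betw_cong[THEN iffD1, rotated]) (simp add: P_def)
  then have "P permutes X"
    by (rule bij_imp_permutes) (simp add: P_def)
  moreover have "\<forall>j\<in>A. P (x j) = f j"
    using x by (auto simp: P_def bij_betw_inv_into_left bij_betwE)
  ultimately show "P permutes X \<and> (\<forall>j\<in>A. P (x j) = f j)" by blast
  fix Q assume Q: "Q permutes X \<and> (\<forall>j\<in>A. Q (x j) = f j)"
  show "Q = P"
  proof
    fix y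
    show "Q y = P y"
    proof (cases "y \<in> X")
      case True
      then obtain j where "j \<in> A" "y = x j" using x by (auto simp: bij_betw_def)
      then show ?thesis using Q \<open>\<forall>j\<in>A. P (x j) = f j\<close> by simp
    next
      case False
      then show ?thesis using Q by (auto simp: P_def dest: permutes_not_in)
    qed
  qed
qed

lemma bij_betw_of_ex1:
  assumes "\<And>i. i \<in> A \<Longrightarrow> f i \<in> B" and "\<And>s. s \<in> B \<Longrightarrow> \<exists>!i. i \<in> A \<and> f i = s"
  shows "bij_betw f A B"
proof -
  have "inj_on f A"
  proof (rule inj_onI)
    fix i j assume "i \<in> A" "j \<in> A" "f i = f j"
    then show "i = j" using assms(2)[OF assms(1)[of j]] by blast
  qed
  moreover have "B \<subseteq> f ` A"
  proof
    fix s assume "s \<in> B"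
    from ex1_implies_ex[OF assms(2)[OF this]] show "s \<in> f ` A" by blast
  qed
  ultimately show ?thesis using assms(1) unfolding bij_betw_def by blast
qed

lemma latin_square_row_bij:
  assumes "latin_square X L" "i \<in> {1..card X}"
  shows "bij_betw (\<lambda>j. L i j) {1..card X} X"
  by (rule bij_betw_of_ex1) (use assms in \<open>simp_all add: latin_square_def\<close>)

lemma latin_square_col_bij:
  assumes "latin_square X L" "j \<in> {1..card X}"
  shows "bij_betw (\<lambda>i. L i j) {1..card X} X"
  by (rule bij_betw_of_ex1) (use assms in \<open>simp_all add: latin_square_def\<close>)

lemma ex1_row_perm:
  assumes "latin_square X L" "bij_betw x {1..card X} X" "i \<in> {1..card X}"
  shows "\<exists>!P. P permutes X \<and> (\<forall>j\<in>{1..card X}. P (x j) = L i j)"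
  using ex1_perm_of_bij[OF assms(2) latin_square_row_bij[OF assms(1,3)]] .

lemma ex1_col_perm:
  assumes "latin_square X L" "bij_betw x {1..card X} X" "j \<in> {1..card X}"
  shows "\<exists>!Q. Q permutes X \<and> (\<forall>i\<in>{1..card X}. Q (x i) = L i j)"
  using ex1_perm_of_bij[OF assms(2) latin_square_col_bij[OF assms(1,3)]] .

lemma ex1_symbol_perm:
  assumes L: "latin_square X L" and x: "bij_betw x {1..card X} X" and s: "s \<in> X"
  shows "\<exists>!R. R permutes X \<and>
           (\<forall>i\<in>{1..card X}. \<forall>j\<in>{1..card X}. R (x i) = x j \<longleftrightarrow> L i j = s)"
proof -
  let ?A = "{1..card X}"
  define c where "c i = (THE j. j \<in> ?A \<and> L i j = s)" for i
  have row: "\<exists>!j. j \<in> ?A \<and> L i j = s" if "i \<in> ?A" for i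
    using L s that unfolding latin_square_def by blast
  have col: "\<exists>!i. i \<in> ?A \<and> L i j = s" if "j \<in> ?A" for j
    using L s that unfolding latin_square_def by blast
  have c: "c i \<in> ?A \<and> L i (c i) = s" if "i \<in> ?A" for i
    unfolding c_def using theI'[OF row[OF that]] .
  have c_iff: "c i = j \<longleftrightarrow> L i j = s" if "i \<in> ?A" "j \<in> ?A" for i j
    using c[OF that(1)] row[OF that(1)] that by blast
  have inj: "inj_on c ?A"
  proof (rule inj_onI)
    fix i k assume ik: "i \<in> ?A" "k \<in> ?A" "c i = c k"
    then show "i = k" using c[OF ik(1)] c[OF ik(2)] col[of "c k"] by auto
  qed
  have "c ` ?A = ?A"
    by (rule endo_inj_surj[OF _ _ inj]) (use c in auto)
  with inj have "bij_betw c ?A ?A" by (simp add: bij_betw_def)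
  then have "bij_betw (\<lambda>i. x (c i)) ?A X"
    using bij_betw_trans[OF _ x, of c ?A] by (simp add: comp_def)
  from ex1_perm_of_bij[OF x this]
  have ex1: "\<exists>!R. R permutes X \<and> (\<forall>i\<in>?A. R (x i) = x (c i))" .
  have "(\<forall>i\<in>?A. R (x i) = x (c i)) \<longleftrightarrow> (\<forall>i\<in>?A. \<forall>j\<in>?A. R (x i) = x j \<longleftrightarrow> L i j = s)" for R
  proof
    assume *: "\<forall>i\<in>?A. R (x i) = x (c i)"
    show "\<forall>i\<in>?A. \<forall>j\<in>?A. R (x i) = x j \<longleftrightarrow> L i j = s"
    proof (intro ballI)
      fix i j assume ij: "i \<in> ?A" "j \<in> ?A"
      have "R (x i) = x j \<longleftrightarrow> c i = j"
        using * ij c[OF ij(1)] bij_betw_imp_inj_on[OF x] by (simp add: inj_on_eq_iff)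
      with c_iff[OF ij] show "R (x i) = x j \<longleftrightarrow> L i j = s" by simp
    qed
  next
    assume "\<forall>i\<in>?A. \<forall>j\<in>?A. R (x i) = x j \<longleftrightarrow> L i j = s"
    then show "\<forall>i\<in>?A. R (x i) = x (c i)" using c by blast
  qed
  with ex1 show ?thesis by simp
qed

lemma ex1_of_bij_betw:
  assumes "bij_betw f A B" "s \<in> B"
  shows "\<exists>!i. i \<in> A \<and> f i = s"
proof -
  obtain i where "i \<in> A" "f i = s" using assms by (auto simp: bij_betw_def)
  then show ?thesis using bij_betw_imp_inj_on[OF assms(1)] by (auto simp: inj_on_eq_iff)
qed

lemma latin_square_group_square:
  assumes "group G" "finite (carrier G)" "h permutes carrier G"
    and g: "bij_betw g {1..card (carrier G)} (carrier G)"
  shows "latin_square (carrier G) (group_square G g h)"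
proof -
  interpret group G by fact
  let ?A = "{1..card (carrier G)}"
  have gc: "g i \<in> carrier G" if "i \<in> ?A" for i
    using g that by (auto dest: bij_betwE)
  have hc: "h y \<in> carrier G" if "y \<in> carrier G" for y
    using assms(3) that by (simp add: permutes_in_image)
  have idx: "\<exists>!j. j \<in> ?A \<and> g j = y" if "y \<in> carrier G" for y
    using ex1_of_bij_betw[OF g that] .
  have hg: "bij_betw (\<lambda>i. h (g i)) ?A (carrier G)"
    using bij_betw_trans[OF g permutes_imp_bij[OF assms(3)]] by (simp add: comp_def)
  have idx': "\<exists>!i. i \<in> ?A \<and> h (g i) = y" if "y \<in> carrier G" for y
    using ex1_of_bij_betw[OF hg that] .
  have row: "\<exists>!j. j \<in> ?A \<and> h (g i) \<otimes>\<^bsub>G\<^esub> g j = s" if i: "i \<in> ?A" and s: "s \<in> carrier G" for i s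
  proof -
    have "(j \<in> ?A \<and> h (g i) \<otimes>\<^bsub>G\<^esub> g j = s) \<longleftrightarrow> (j \<in> ?A \<and> g j = inv\<^bsub>G\<^esub> h (g i) \<otimes>\<^bsub>G\<^esub> s)" for j
      using gc hc i s by (metis inv_solve_left)
    with idx[of "inv\<^bsub>G\<^esub> h (g i) \<otimes>\<^bsub>G\<^esub> s"] show ?thesis using gc hc i s by simp
  qed
  have col: "\<exists>!i. i \<in> ?A \<and> h (g i) \<otimes>\<^bsub>G\<^esub> g j = s" if j: "j \<in> ?A" and s: "s \<in> carrier G" for j s
  proof -
    have "(i \<in> ?A \<and> h (g i) \<otimes>\<^bsub>G\<^esub> g j = s) \<longleftrightarrow> (i \<in> ?A \<and> h (g i) = s \<otimes>\<^bsub>G\<^esub> inv\<^bsub>G\<^esub> g j)" for i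
      using gc hc j s by (metis inv_solve_right)
    with idx'[of "s \<otimes>\<^bsub>G\<^esub> inv\<^bsub>G\<^esub> g j"] show ?thesis using gc hc j s by simp
  qed
  show ?thesis
    unfolding latin_square_def group_square_def using assms(2) gc hc row col by auto
qed

end

theory Submission imports Defs "HOL-Algebra.Multiplicative_Group" begin

text \<open>
  Write \<open>\<lambda>\<^sub>a\<close> for left translation by \<open>a\<close> and \<open>\<iota>\<close> for inversion in \<open>G\<close>. The row permutations of
  \<open>L\<^sub>h\<close> are the left translations, each occurring once because \<open>h\<close> is a bijection. The column
  permutation of \<open>b\<close> maps \<open>x\<close> to \<open>h(x) b = (b\<inverse> h(x)\<inverse>)\<inverse>\<close>, so it is \<open>\<iota> \<circ> \<lambda>\<^sub>y \<circ> \<iota> \<circ> h\<close> with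
  \<open>y = b\<inverse>\<close>. The symbol permutation of \<open>s\<close> maps \<open>x\<close> to \<open>h(x)\<inverse> s = (s\<inverse> h(x))\<inverse>\<close>, so it is
  \<open>\<iota> \<circ> \<lambda>\<^sub>y \<circ> h\<close> with \<open>y = s\<inverse>\<close>. In both cases \<open>y\<close> runs through \<open>G\<close>. With \<open>n = |G|\<close> and \<open>S\<close> the sum of the parities of all left translations, the
  three parities are therefore \<open>S\<close>, \<open>S + n \<pi>(h)\<close> and \<open>S + n (\<pi>(\<iota>) + \<pi>(h))\<close>.

  It remains to find \<open>S\<close>, and \<open>\<pi>(\<iota>)\<close> for odd \<open>n\<close>. Both rest on the parity of an involution, which
  is a product of as many disjoint transpositions as half the number of points it moves
  (\<open>perm_parity_involution\<close>). In a group of odd order inversion moves every element but the unit,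
  so \<open>\<pi>(\<iota>)\<close> is \<open>(n - 1) / 2\<close> modulo 2. The map taking \<open>a\<close> to the parity of \<open>\<lambda>\<^sub>a\<close> is a homomorphism
  to the field with two elements, so \<open>S\<close> is either \<open>0\<close> or, if the homomorphism is onto, \<open>n / 2\<close>
  modulo 2 (\<open>sum_hom_to_bit\<close>). This already gives \<open>S = 0\<close> unless \<open>n\<close> is \<open>2\<close> modulo 4. In that
  case \<open>G\<close> contains an element \<open>t\<close> of order two, and \<open>\<lambda>\<^sub>t\<close> is an involution without fixed points,
  hence a product of the odd number \<open>n / 2\<close> of transpositions. So the homomorphism is onto, and
  \<open>S = 1\<close>.
\<close>

section \<open>Parities of permutations\<close>

lemma of_nat_bit: "(of_nat n :: bit) = (if even n then 0 else 1)"
  by (induction n) auto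

lemma bit_add_self: "b + b = (0 :: bit)"
  by (cases b) simp_all

lemma perm_parity_comp:
  assumes "permutation p" "permutation q"
  shows "perm_parity (p \<circ> q) = perm_parity p + perm_parity q"
  using evenperm_comp[OF assms] by (simp add: perm_parity_def)

text \<open>
  The moved points of an involution fall into pairs \<open>{a, f a}\<close>. Composing with the transposition
  of one such pair fixes its two points, changes nothing else, and flips the parity.
\<close>

lemma perm_parity_involution:
  assumes "finite {x. f x \<noteq> x}" and "\<And>x. f (f x) = x"
  shows "\<exists>k. card {x. f x \<noteq> x} = 2 * k \<and> perm_parity f = of_nat k"
  using assms
proof (induction "card {x. f x \<noteq> x}" arbitrary: f rule: less_induct)
  case less
  show ?case
  proof (cases "{x. f x \<noteq> x} = {}")
    case True
    then have "f = id" by auto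
    then show ?thesis by (simp add: perm_parity_def)
  next
    case False
    then obtain a where a: "f a \<noteq> a" by auto
    define f' where "f' = transpose a (f a) \<circ> f"
    have f_eq: "f = transpose a (f a) \<circ> f'"
      by (simp add: f'_def fun_eq_iff)
    have swap: "f x = y \<longleftrightarrow> x = f y" for x y
      using less.prems(2) by metis
    have f'_apply: "f' x = (if x \<in> {a, f a} then x else f x)" for x
      using less.prems(2) by (simp add: f'_def transpose_def swap)
    have invol': "f' (f' x) = x" for x
      by (simp add: f'_apply swap less.prems(2))
    have moved: "{x. f x \<noteq> x} = insert a (insert (f a) {x. f' x \<noteq> x})"
      using a less.prems(2) by (auto simp: f'_apply)
    have fin': "finite {x. f' x \<noteq> x}"
      by (rule finite_subset[OF _ less.prems(1)]) (auto simp: f'_apply)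
    have card: "card {x. f x \<noteq> x} = card {x. f' x \<noteq> x} + 2"
      unfolding moved using fin' a by (subst card_insert_disjoint; auto simp: f'_apply)
    then obtain k where k: "card {x. f' x \<noteq> x} = 2 * k" "perm_parity f' = of_nat k"
      using less.hyps[OF _ fin' invol'] by auto
    have "permutation f'"
      using fin' involuntory_imp_bij[of f'] invol' by (simp add: permutation)
    then have "perm_parity f = perm_parity (transpose a (f a)) + perm_parity f'"
      by (subst f_eq) (simp add: perm_parity_comp permutation_swap_id)
    then have "perm_parity f = of_nat (Suc k)"
      using a k(2) by (simp add: perm_parity_def evenperm_swap)
    moreover have "card {x. f x \<noteq> x} = 2 * Suc k"
      using card k(1) by simp
    ultimately show ?thesis by blast
  qed
qed

section \<open>Translations and inversion in a finite group\<close>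

text \<open>
  Extension by the identity off the carrier turns these bijections of the carrier into elements of
  its symmetric group.
\<close>

definition left_translation :: "('a, 'b) monoid_scheme \<Rightarrow> 'a \<Rightarrow> 'a \<Rightarrow> 'a" where
  "left_translation G a = restrict_id (\<lambda>x. a \<otimes>\<^bsub>G\<^esub> x) (carrier G)"

definition inversion :: "('a, 'b) monoid_scheme \<Rightarrow> 'a \<Rightarrow> 'a" where
  "inversion G = restrict_id (\<lambda>x. inv\<^bsub>G\<^esub> x) (carrier G)"

context group
begin

lemma bij_betw_m_inv: "bij_betw (\<lambda>x. inv x) (carrier G) (carrier G)"
  by (rule bij_betw_byWitness[where f' = "\<lambda>x. inv x"]) auto

lemma left_translation_permutes:
  assumes "a \<in> carrier G"
  shows "left_translation G a permutes carrier G"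
  unfolding left_translation_def
  using assms by (intro permutes_restrict_id) (simp add: bij_betw_def inj_on_cmult surj_const_mult)

lemma inversion_permutes: "inversion G permutes carrier G"
  unfolding inversion_def by (rule permutes_restrict_id[OF bij_betw_m_inv])

lemma left_translation_mult:
  assumes "a \<in> carrier G" "b \<in> carrier G"
  shows "left_translation G (a \<otimes> b) = left_translation G a \<circ> left_translation G b"
  using assms by (auto simp: left_translation_def restrict_id_def m_assoc)

lemma inversion_inversion: "inversion G (inversion G x) = x"
  by (simp add: inversion_def restrict_id_def)

text \<open>
  If \<open>p\<close> takes the value \<open>1\<close> at \<open>c\<close>, then translation by \<open>c\<close> exchanges the two fibres of \<open>p\<close>, so
  each of them contains half of the group.
\<close>

lemma sum_hom_to_bit:
  fixes p :: "'a \<Rightarrow> bit"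
  assumes fin: "finite (carrier G)"
    and hom: "\<And>a b. a \<in> carrier G \<Longrightarrow> b \<in> carrier G \<Longrightarrow> p (a \<otimes> b) = p a + p b"
    and c: "c \<in> carrier G" "p c = 1"
  shows "\<exists>m. order G = 2 * m \<and> (\<Sum>a\<in>carrier G. p a) = of_nat m"
proof -
  let ?F = "\<lambda>b. {a \<in> carrier G. p a = b}"
  have c_inv: "p (inv c) = 1"
  proof -
    have "p \<one> = 0" using hom[of \<one> \<one>] by (simp add: bit_add_self)
    then show ?thesis using hom[of c "inv c"] c by (cases "p (inv c)") auto
  qed
  have "bij_betw (\<lambda>a. c \<otimes> a) (?F 0) (?F 1)"
    by (rule bij_betw_byWitness[where f' = "\<lambda>a. inv c \<otimes> a"])
      (use c c_inv in \<open>auto simp: hom m_assoc[symmetric]\<close>)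
  then have eq: "card (?F 0) = card (?F 1)" by (rule bij_betw_same_card)
  have "carrier G = ?F 0 \<union> ?F 1" by auto
  then have "order G = card (?F 0) + card (?F 1)"
    unfolding order_def using fin by (subst card_Un_disjoint[symmetric]) auto
  moreover have "(\<Sum>a\<in>carrier G. p a) = of_nat (card (?F 1))"
  proof -
    have "(\<Sum>a\<in>carrier G. p a) = (\<Sum>a\<in>?F 1. p a)"
      by (rule sum.mono_neutral_right) (use fin in auto)
    also have "\<dots> = (\<Sum>a\<in>?F 1. 1)" by (rule sum.cong) auto
    finally show ?thesis by simp
  qed
  ultimately show ?thesis using eq by (intro exI[of _ "card (?F 1)"]) simp
qed

text \<open>
  Inversion pairs off the elements that differ from their inverses, so in even order the number of
  the others is even; as the unit is among them, there must be a second one.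
\<close>

lemma ex_order_two:
  assumes fin: "finite (carrier G)" and "even (order G)"
  shows "\<exists>t \<in> carrier G. t \<noteq> \<one> \<and> t \<otimes> t = \<one>"
proof (rule ccontr)
  assume "\<not> ?thesis"
  then have "x = \<one>" if "x \<in> carrier G" "inv x = x" for x
    using that by (metis r_inv)
  then have "{x. inversion G x \<noteq> x} = carrier G - {\<one>}"
    by (auto simp: inversion_def restrict_id_def)
  moreover have "\<exists>k. card {x. inversion G x \<noteq> x} = 2 * k"
    using perm_parity_involution[of "inversion G"] fin inversion_inversion calculation by auto
  moreover have "card (carrier G - {\<one>}) = order G - 1" "order G > 0"
    using fin order_gt_0_iff_finite by (simp_all add: order_def)
  ultimately obtain k where "order G - 1 = 2 * k" "order G > 0" by auto
  with \<open>even (order G)\<close> show False by presburger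
qed

lemma perm_parity_left_translation_mult:
  assumes "finite (carrier G)" "a \<in> carrier G" "b \<in> carrier G"
  shows "perm_parity (left_translation G (a \<otimes> b)) =
    perm_parity (left_translation G a) + perm_parity (left_translation G b)"
  unfolding left_translation_mult[OF assms(2,3)]
  by (intro perm_parity_comp permutes_imp_permutation[OF assms(1)] left_translation_permutes
      assms(2,3))

lemma sum_perm_parity_left_translation:
  assumes fin: "finite (carrier G)"
  shows "(\<Sum>a\<in>carrier G. perm_parity (left_translation G a)) = (if order G mod 4 = 2 then 1 else 0)"
proof (cases "\<exists>c\<in>carrier G. perm_parity (left_translation G c) = 1")
  case True
  then obtain m where "order G = 2 * m"
    "(\<Sum>a\<in>carrier G. perm_parity (left_translation G a)) = of_nat m"
    using sum_hom_to_bit[of "\<lambda>a. perm_parity (left_translation G a)"] fin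
      perm_parity_left_translation_mult by blast
  moreover have "2 * m mod 4 = 2 \<longleftrightarrow> odd m" by presburger
  ultimately show ?thesis by (simp add: of_nat_bit)
next
  case False
  have "order G mod 4 \<noteq> 2"
  proof
    assume n: "order G mod 4 = 2"
    then have "even (order G)" by presburger
    then obtain t where t: "t \<in> carrier G" "t \<noteq> \<one>" "t \<otimes> t = \<one>"
      using ex_order_two[OF fin] by blast
    have "left_translation G t (left_translation G t x) = x" for x
      using t by (simp add: left_translation_def restrict_id_def m_assoc[symmetric])
    moreover have "{x. left_translation G t x \<noteq> x} = carrier G"
      using t by (auto simp: left_translation_def restrict_id_def)
    ultimately obtain k where "order G = 2 * k" "perm_parity (left_translation G t) = of_nat k"
      using perm_parity_involution[of "left_translation G t"] fin by (auto simp: order_def)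
    moreover from this n have "odd k" by presburger
    ultimately show False using False t(1) by (simp add: of_nat_bit)
  qed
  with False show ?thesis by simp
qed

text \<open>
  By Lagrange, a group of odd order contains no element of order two, so inversion fixes the unit
  only.
\<close>

lemma perm_parity_inversion:
  assumes fin: "finite (carrier G)" and odd: "odd (order G)"
  shows "perm_parity (inversion G) = (if order G mod 4 = 1 then 0 else 1)"
proof -
  have "x = \<one>" if x: "x \<in> carrier G" "inv x = x" for x
  proof -
    have "x [^] (2::nat) = \<one>" using x r_inv[of x] by (simp add: numeral_2_eq_2)
    then have "ord x dvd 2" using x by (simp add: pow_eq_id)
    moreover have "odd (ord x)" using ord_dvd_group_order[OF x(1)] odd dvd_trans by blast
    ultimately have "ord x = 1" using coprime_common_divisor_nat[of 2 "ord x" "ord x"] by simp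
    then show ?thesis using x ord_eq_1 by simp
  qed
  then have moved: "{x. inversion G x \<noteq> x} = carrier G - {\<one>}"
    by (auto simp: inversion_def restrict_id_def)
  obtain k where k: "card (carrier G - {\<one>}) = 2 * k" "perm_parity (inversion G) = of_nat k"
    using perm_parity_involution[of "inversion G"] inversion_inversion fin unfolding moved by auto
  have "order G = 2 * k + 1"
    using k(1) odd_pos[OF odd] fin by (simp add: order_def)
  moreover have "(2 * k + 1) mod 4 = 1 \<longleftrightarrow> even k" by presburger
  ultimately show ?thesis using k(2) by (simp add: of_nat_bit)
qed

end

section \<open>The three parities of the square\<close>

context group
begin

context
  fixes g :: "nat \<Rightarrow> 'a" and h :: "'a \<Rightarrow> 'a"
  assumes fin: "finite (carrier G)"
    and g: "bij_betw g {1..card (carrier G)} (carrier G)"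
    and h: "h permutes carrier G"
begin

lemma g_closed: "i \<in> {1..card (carrier G)} \<Longrightarrow> g i \<in> carrier G"
  using g by (rule bij_betwE[rule_format])

lemma h_closed: "x \<in> carrier G \<Longrightarrow> h x \<in> carrier G"
  using h by (simp add: permutes_in_image)

lemma latin_group_square: "latin_square (carrier G) (group_square G g h)"
  by (rule latin_square_group_square) (use group_axioms fin g h in auto)

lemma row_perm_group_square:
  assumes i: "i \<in> {1..card (carrier G)}"
  shows "row_perm (carrier G) g (group_square G g h) i = left_translation G (h (g i))"
  unfolding row_perm_def
proof (rule the1_equality[OF ex1_row_perm[OF latin_group_square g i]], intro conjI ballI)
  show "left_translation G (h (g i)) permutes carrier G"
    using i by (simp add: left_translation_permutes h_closed g_closed)
qed (use g_closed in \<open>simp add: left_translation_def group_square_def\<close>)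

lemma col_perm_group_square:
  assumes j: "j \<in> {1..card (carrier G)}"
  shows "col_perm (carrier G) g (group_square G g h) j =
    inversion G \<circ> (left_translation G (inv (g j)) \<circ> (inversion G \<circ> h))"
  unfolding col_perm_def
proof (rule the1_equality[OF ex1_col_perm[OF latin_group_square g j]], intro conjI ballI)
  show "inversion G \<circ> (left_translation G (inv (g j)) \<circ> (inversion G \<circ> h)) permutes carrier G"
    using g_closed[OF j]
    by (intro permutes_compose h inversion_permutes left_translation_permutes) auto
qed (use g_closed h_closed j in
    \<open>simp add: left_translation_def inversion_def group_square_def inv_mult_group\<close>)

lemma symbol_perm_group_square:
  assumes s: "s \<in> carrier G"
  shows "symbol_perm (carrier G) g (group_square G g h) s =
    inversion G \<circ> (left_translation G (inv s) \<circ> h)"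
  unfolding symbol_perm_def
proof (rule the1_equality[OF ex1_symbol_perm[OF latin_group_square g s]], intro conjI ballI)
  show "inversion G \<circ> (left_translation G (inv s) \<circ> h) permutes carrier G"
    using s by (intro permutes_compose h inversion_permutes left_translation_permutes) auto
next
  fix i j assume ij: "i \<in> {1..card (carrier G)}" "j \<in> {1..card (carrier G)}"
  have "(inversion G \<circ> (left_translation G (inv s) \<circ> h)) (g i) = inv (h (g i)) \<otimes> s"
    using ij s g_closed h_closed by (simp add: left_translation_def inversion_def inv_mult_group)
  moreover have "inv (h (g i)) \<otimes> s = g j \<longleftrightarrow> h (g i) \<otimes> g j = s"
    using ij s g_closed h_closed by (metis inv_solve_left)
  ultimately show "(inversion G \<circ> (left_translation G (inv s) \<circ> h)) (g i) = g j \<longleftrightarrow>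
      group_square G g h i j = s"
    by (simp add: group_square_def)
qed

lemma permutation_h: "permutation h"
  using fin h by (rule permutes_imp_permutation)

lemma permutation_inversion: "permutation (inversion G)"
  using fin inversion_permutes by (rule permutes_imp_permutation)

lemma permutation_left_translation:
  "a \<in> carrier G \<Longrightarrow> permutation (left_translation G a)"
  using fin left_translation_permutes by (rule permutes_imp_permutation)

lemma row_parity_group_square:
  "row_parity (carrier G) g (group_square G g h) =
    (\<Sum>a\<in>carrier G. perm_parity (left_translation G a))"
proof -
  have "bij_betw (\<lambda>i. h (g i)) {1..card (carrier G)} (carrier G)"
    using bij_betw_trans[OF g permutes_imp_bij[OF h]] by (simp add: comp_def)
  then show ?thesis
    unfolding row_parity_def using row_perm_group_square
    by (simp flip: sum.reindex_bij_betw)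
qed

lemma col_parity_group_square:
  "col_parity (carrier G) g (group_square G g h) =
    (\<Sum>a\<in>carrier G. perm_parity (left_translation G a)) + of_nat (order G) * perm_parity h"
proof -
  have "bij_betw (\<lambda>j. inv (g j)) {1..card (carrier G)} (carrier G)"
    using bij_betw_trans[OF g bij_betw_m_inv] by (simp add: comp_def)
  note reindex = sum.reindex_bij_betw[OF this, of "\<lambda>a. perm_parity (left_translation G a)"]
  have "perm_parity (col_perm (carrier G) g (group_square G g h) j) =
      perm_parity (left_translation G (inv (g j))) + perm_parity h"
    if j: "j \<in> {1..card (carrier G)}" for j
  proof -
    have "perm_parity (col_perm (carrier G) g (group_square G g h) j) =
        perm_parity (inversion G) + (perm_parity (left_translation G (inv (g j))) +
          (perm_parity (inversion G) + perm_parity h))"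
      using g_closed[OF j]
      by (simp add: col_perm_group_square[OF j] perm_parity_comp permutation_compose
          permutation_inversion permutation_left_translation permutation_h del: add_bit_eq_xor)
    then show ?thesis by (cases "perm_parity (inversion G)") (simp_all add: ac_simps)
  qed
  then have "col_parity (carrier G) g (group_square G g h) =
      (\<Sum>j\<in>{1..card (carrier G)}. perm_parity (left_translation G (inv (g j))) + perm_parity h)"
    unfolding col_parity_def by (intro sum.cong) auto
  also have "\<dots> = (\<Sum>j\<in>{1..card (carrier G)}. perm_parity (left_translation G (inv (g j)))) +
      of_nat (order G) * perm_parity h"
    by (simp add: sum.distrib order_def del: add_bit_eq_xor mult_bit_eq_and)
  finally show ?thesis unfolding reindex .
qed

lemma symbol_parity_group_square:
  "symbol_parity (carrier G) g (group_square G g h) =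
    (\<Sum>a\<in>carrier G. perm_parity (left_translation G a)) +
    of_nat (order G) * (perm_parity (inversion G) + perm_parity h)"
proof -
  note reindex = sum.reindex_bij_betw[OF bij_betw_m_inv,
      of "\<lambda>a. perm_parity (left_translation G a)"]
  have "symbol_parity (carrier G) g (group_square G g h) =
      (\<Sum>s\<in>carrier G. perm_parity (left_translation G (inv s)) +
        (perm_parity (inversion G) + perm_parity h))"
    unfolding symbol_parity_def
    by (intro sum.cong refl)
      (simp add: symbol_perm_group_square perm_parity_comp permutation_compose ac_simps
        permutation_inversion permutation_left_translation permutation_h del: add_bit_eq_xor)
  also have "\<dots> = (\<Sum>s\<in>carrier G. perm_parity (left_translation G (inv s))) +
      of_nat (order G) * (perm_parity (inversion G) + perm_parity h)"
    by (simp add: sum.distrib order_def distrib_left del: add_bit_eq_xor mult_bit_eq_and)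
  finally show ?thesis unfolding reindex .
qed

end

end

theorem theorem5p2p7:
  fixes G :: "('a, 'b) monoid_scheme"
    and g :: "nat \<Rightarrow> 'a"
    and h :: "'a \<Rightarrow> 'a"
  assumes "group G"
    and "finite (carrier G)"
    and "bij_betw g {1..order G} (carrier G)"
    and "h permutes carrier G"
  shows "FHW_parity (carrier G) g (group_square G g h) =
    (if order G mod 4 = 0 then (0, 0, 0)
     else if order G mod 4 = 1 then (0, perm_parity h, perm_parity h)
     else if order G mod 4 = 2 then (1, 1, 1)
     else (0, perm_parity h, perm_parity h + 1))"
proof -
  interpret group G by fact
  have g: "bij_betw g {1..card (carrier G)} (carrier G)"
    using assms(3) by (simp add: order_def)
  note parities = row_parity_group_square[OF assms(2) g assms(4)]
    col_parity_group_square[OF assms(2) g assms(4)]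
    symbol_parity_group_square[OF assms(2) g assms(4)]
    sum_perm_parity_left_translation[OF assms(2)]
  have even_iff: "even (order G) \<longleftrightarrow> order G mod 4 = 0 \<or> order G mod 4 = 2"
    by presburger
  have "order G mod 4 = 0 \<or> order G mod 4 = 1 \<or> order G mod 4 = 2 \<or> order G mod 4 = 3"
    by presburger
  then show ?thesis
    unfolding FHW_parity_def parities of_nat_bit even_iff
    by (elim disjE)
      (simp_all add: even_iff perm_parity_inversion[OF assms(2)] add.commute del: add_bit_eq_xor)
qed

end
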